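(* Assuming ZFC (in particular the axiom of choice), there exists a total problem $f:\mathbb{N}^\mathbb{N}\rightrightarrows\mathbb{N}^\mathbb{N}$ that is parallelizable, discontinuous, but not effectively discontinuous.
   Context: Baire space carries the identity representation. A problem $f:\subseteq\mathbb{N}^\mathbb{N}\rightrightarrows\mathbb{N}^\mathbb{N}$ is a partial multivalued function having a realizer $F:\subseteq\mathbb{N}^\mathbb{N}\to\mathbb{N}^\mathbb{N}$ (i.e. $F(p)\in f(p)$ for all $p\in\mathrm{dom}(f)$); $f$ is continuous if it has a continuous realizer, discontinuous otherwise. $\Phi$ is the standard total representation of continuous partial functions on Baire space: for each $q$, $\Phi_q:\subseteq\mathbb{N}^\mathbb{N}\to\mathbb{N}^\mathbb{N}$ is the continuous function $p\mapsto\sup_{w\sqsubseteq p}h(w)$ (defined where infinite) for the monotone word function $h$ whose graph is listed by $q$; every continuous partial function on Baire space has an extension of the form $\Phi_q$. $f$ is effectively discontinuous if there is a continuous total $D:\mathbb{N}^\mathbb{N}\to\mathbb{N}^\mathbb{N}$ with $D(q)\in\mathrm{dom}(f)$ and $\Phi_qD(q)\notin f(D(q))$ for all $q$ (the latter counting as satisfied when $\Phi_qD(q)$ is undefined). Weihrauch reducibility: $f\le_{\mathrm W}g$ if there are computable $H,K$ such that $p\mapsto H\langle p,GK(p)\rangle$ realizes $f$ for every realizer $G$ of $g$, where $\langle p,q\rangle(2n)=p(n)$, $\langle p,q\rangle(2n+1)=q(n)$; $\equiv_{\mathrm W}$ is the induced equivalence. Let $\langle p_0,p_1,\dots\rangle$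 denote the standard infinite tupling on Baire space, $\langle p_0,p_1,\dots\rangle\langle i,j\rangle=p_i(j)$ with Cantor pairing $\langle i,j\rangle$ on $\mathbb{N}$. The parallelization of $f$ is $\langle f\rangle:\subseteq\mathbb{N}^\mathbb{N}\rightrightarrows\mathbb{N}^\mathbb{N}$, $\langle p_0,p_1,\dots\rangle\mapsto\{\langle q_0,q_1,\dots\rangle: q_i\in f(p_i)\text{ for all }i\}$ (defined when all $p_i\in\mathrm{dom}(f)$), and $f$ is parallelizable if $f\equiv_{\mathrm W}\langle f\rangle$. *)

theory Defs
  imports
    "HOL-Analysis.Function_Topology"
    "HOL-Library.Nat_Bijection"
    "HOL-Library.Sublist"
begin

text \<open>Baire space carries the library's product topology on \<open>nat \<Rightarrow> nat\<close>, with \<open>nat\<close> discrete.\<close>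

type_synonym baire = "nat \<Rightarrow> nat"

text \<open>
  A partial multivalued function \<open>f\<close> is represented by the map sending \<open>p\<close> to the set of its
  values; \<open>p\<close> lies in the domain iff this set is nonempty, so every such \<open>f\<close> has a realizer
  and is a problem.
\<close>

type_synonym problem = "baire \<Rightarrow> baire set"

definition pdom :: "problem \<Rightarrow> baire set" where
  "pdom f = {p. f p \<noteq> {}}"

definition total_problem :: "problem \<Rightarrow> bool" where
  "total_problem f \<longleftrightarrow> pdom f = UNIV"

definition realizer :: "(baire \<rightharpoonup> baire) \<Rightarrow> problem \<Rightarrow> bool" where
  "realizer F f \<longleftrightarrow> (\<forall>p\<in>pdom f. \<exists>r. F p = Some r \<and> r \<in> f p)"

definition continuous_partial :: "(baire \<rightharpoonup> baire) \<Rightarrow> bool" where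
  "continuous_partial F \<longleftrightarrow> continuous_on (dom F) (\<lambda>p. the (F p))"

definition discontinuous :: "problem \<Rightarrow> bool" where
  "discontinuous f \<longleftrightarrow> \<not> (\<exists>F. realizer F f \<and> continuous_partial F)"

definition entry :: "baire \<Rightarrow> nat \<Rightarrow> nat list \<times> nat list" where
  "entry q i = map_prod list_decode list_decode (prod_decode (q i))"

text \<open>
  The representation is total, so an arbitrary \<open>q\<close> has to be read as a listing of a monotone word
  function: entries are used only as long as the finite relation listed so far is the graph of a
  partial monotone function (the condition also forces single-valuedness, by antisymmetry of
  \<open>prefix\<close>). If \<open>q\<close> lists the graph of a monotone function, nothing is discarded.
\<close>

definition listed_graph :: "baire \<Rightarrow> (nat list \<times> nat list) set" where
  "listed_graph q = {entry q i | i. \<forall>j\<le>i. \<forall>k\<le>i.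
      prefix (fst (entry q j)) (fst (entry q k)) \<longrightarrow> prefix (snd (entry q j)) (snd (entry q k))}"

text \<open>
  The total monotone word function given by \<open>q\<close>: its value at \<open>w\<close> is the longest word listed for
  a prefix of \<open>w\<close> (and the empty word if there is none).
\<close>

definition word_fun :: "baire \<Rightarrow> nat list \<Rightarrow> nat list" where
  "word_fun q w = (let C = insert [] {v. \<exists>u. prefix u w \<and> (u, v) \<in> listed_graph q}
     in THE v. v \<in> C \<and> (\<forall>v'\<in>C. prefix v' v))"

definition initial :: "baire \<Rightarrow> nat \<Rightarrow> nat list" where
  "initial p m = map p [0..<m]"

definition Phi :: "baire \<Rightarrow> baire \<rightharpoonup> baire" where
  "Phi q p = (if \<forall>n. \<exists>m. n < length (word_fun q (initial p m))
     then Some (THE r. \<forall>m. \<exists>n. word_fun q (initial p m) = initial r n)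
     else None)"

lemma listed_graph_prefix:
  assumes "(u, v) \<in> listed_graph q" "(u', v') \<in> listed_graph q" "prefix u u'"
  shows "prefix v v'"
proof -
  obtain i where i: "entry q i = (u, v)" and ci: "\<forall>j\<le>i. \<forall>k\<le>i.
      prefix (fst (entry q j)) (fst (entry q k)) \<longrightarrow> prefix (snd (entry q j)) (snd (entry q k))"
    using assms(1) unfolding listed_graph_def by auto
  obtain j where j: "entry q j = (u', v')" and cj: "\<forall>i\<le>j. \<forall>k\<le>j.
      prefix (fst (entry q i)) (fst (entry q k)) \<longrightarrow> prefix (snd (entry q i)) (snd (entry q k))"
    using assms(2) unfolding listed_graph_def by auto
  show ?thesis
  proof (cases "i \<le> j")
    case True
    then show ?thesis using cj[rule_format, of i j] i j assms(3) by simp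
  next
    case False
    then have "j \<le> i" by simp
    then show ?thesis using ci[rule_format, of i j] i j assms(3) by simp
  qed
qed

lemma word_fun_props:
  defines "C \<equiv> \<lambda>q w. insert [] {v. \<exists>u. prefix u w \<and> (u, v) \<in> listed_graph q}"
  shows "word_fun q w \<in> C q w" and "v \<in> C q w \<Longrightarrow> prefix v (word_fun q w)"
proof -
  let ?V = "{v. \<exists>u. prefix u w \<and> (u, v) \<in> listed_graph q}"
  have "\<exists>v. v \<in> C q w \<and> (\<forall>v'\<in>C q w. prefix v' v)"
  proof (cases "?V = {}")
    case True
    then show ?thesis unfolding C_def by auto
  next
    case False
    define U where "U = {u. prefix u w \<and> (\<exists>v. (u, v) \<in> listed_graph q)}"
    have "finite U"
      by (rule finite_subset[of _ "set (prefixes w)"]) (auto simp: U_def)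
    moreover have "U \<noteq> {}" using False by (auto simp: U_def)
    ultimately have "Max (length ` U) \<in> length ` U" and le: "\<forall>u'\<in>U. length u' \<le> Max (length ` U)"
      by simp_all
    then obtain u where u: "u \<in> U" "\<forall>u'\<in>U. length u' \<le> length u" by auto
    then obtain v where v: "(u, v) \<in> listed_graph q" "prefix u w" by (auto simp: U_def)
    have "prefix v' v" if "v' \<in> ?V" for v'
    proof -
      obtain u' where u': "prefix u' w" "(u', v') \<in> listed_graph q" using \<open>v' \<in> ?V\<close> by auto
      then have "length u' \<le> length u" using u by (auto simp: U_def)
      then have "prefix u' u" using u' v(2) prefix_length_prefix by blast
      then show ?thesis using listed_graph_prefix u' v(1) by blast
    qed
    then show ?thesis using v unfolding C_def by auto
  qed
  then have "\<exists>!v. v \<in> C q w \<and> (\<forall>v'\<in>C q w. prefix v' v)"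
    by (auto intro: prefix_order.antisym)
  from theI'[OF this]
  have *: "word_fun q w \<in> C q w \<and> (\<forall>v'\<in>C q w. prefix v' (word_fun q w))"
    unfolding word_fun_def C_def Let_def .
  show "word_fun q w \<in> C q w" using * by blast
  show "v \<in> C q w \<Longrightarrow> prefix v (word_fun q w)" using * by blast
qed

lemma word_fun_mono: "prefix w w' \<Longrightarrow> prefix (word_fun q w) (word_fun q w')"
  using word_fun_props(1)[of q w]
  by (intro word_fun_props(2)) (auto intro: prefix_order.trans)

lemma word_fun_eq:
  assumes mono: "\<And>w w'. prefix w w' \<Longrightarrow> prefix (h w) (h w')"
    and listing: "range (entry q) = {(w, h w) | w. True}"
  shows "word_fun q = h"
proof
  fix w
  have e: "snd (entry q i) = h (fst (entry q i))" for i
  proof -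
    have "entry q i \<in> {(w, h w) | w. True}" using listing by blast
    then show ?thesis by auto
  qed
  have g: "listed_graph q = {(w, h w) | w. True}"
    unfolding listing[symmetric] listed_graph_def using mono by (auto simp: e)
  have "prefix (h w) (word_fun q w)"
    by (rule word_fun_props(2)) (auto simp: g)
  moreover have "prefix (word_fun q w) (h w)"
    using word_fun_props(1)[of q w] mono by (auto simp: g)
  ultimately show "word_fun q w = h w" by (rule prefix_order.antisym[rotated])
qed

lemma Phi_eq_SomeD:
  assumes "Phi q p = Some r"
  shows "\<exists>n. word_fun q (initial p m) = initial r n"
proof -
  let ?h = "\<lambda>m. word_fun q (initial p m)"
  have unb: "\<forall>n. \<exists>m. n < length (?h m)" and r: "r = (THE r. \<forall>m. \<exists>n. ?h m = initial r n)"
    using assms by (auto simp: Phi_def split: if_splits)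
  have pre: "prefix (initial p i) (initial p j)" if "i \<le> j" for i j
    unfolding initial_def using upt_add_eq_append[of 0 i "j - i"] that by (auto simp: prefix_def)
  have agree: "?h i ! n = ?h j ! n" if "n < length (?h i)" "n < length (?h j)" for i j n
  proof -
    have "prefix (?h i) (?h j) \<or> prefix (?h j) (?h i)"
      using pre[of i j] pre[of j i] word_fun_mono nat_le_linear[of i j] by blast
    then show ?thesis using that by (auto simp: prefix_def nth_append)
  qed
  obtain M where M: "\<And>n. n < length (?h (M n))" using unb by metis
  define s where "s n = ?h (M n) ! n" for n
  have s: "?h m = initial s (length (?h m))" for m
  proof (rule nth_equalityI)
    fix n assume n: "n < length (?h m)"
    then have "initial s (length (?h m)) ! n = ?h (M n) ! n" by (simp add: initial_def s_def)
    also have "\<dots> = ?h m ! n" using M n by (rule agree)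
    finally show "?h m ! n = initial s (length (?h m)) ! n" by simp
  qed (simp add: initial_def)
  have "\<exists>!r. \<forall>m. \<exists>n. ?h m = initial r n"
  proof (rule ex1I[of _ s])
    show "\<forall>m. \<exists>n. ?h m = initial s n" using s by blast
    fix t assume t: "\<forall>m. \<exists>n. ?h m = initial t n"
    show "t = s"
    proof
      fix n
      obtain l where "?h (M n) = initial t l" using t by blast
      then show "t n = s n" using M[of n] by (simp add: s_def initial_def)
    qed
  qed
  from theI'[OF this] show ?thesis unfolding r by blast
qed

definition effectively_discontinuous :: "problem \<Rightarrow> bool" where
  "effectively_discontinuous f \<longleftrightarrow> (\<exists>D :: baire \<Rightarrow> baire. continuous_on UNIV D \<and>
     (\<forall>q. D q \<in> pdom f \<and> (\<forall>r. Phi q (D q) = Some r \<longrightarrow> r \<notin> f (D q))))"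

text \<open>
  A partial function on Baire space is computable if a single program, here a partial recursive
  function with oracle, computes the \<open>n\<close>-th entry of the value on input \<open>n\<close> from oracle \<open>p\<close>, for
  all \<open>p\<close> in the domain.
\<close>

datatype recf = Zero | Succ | Proj nat | Oracle
  | Comp recf "recf list" | PrimRec recf recf | Mu recf

inductive computes :: "baire \<Rightarrow> recf \<Rightarrow> nat list \<Rightarrow> nat \<Rightarrow> bool" for p where
  zero: "computes p Zero xs 0"
| succ: "computes p Succ [x] (Suc x)"
| proj: "i < length xs \<Longrightarrow> computes p (Proj i) xs (xs ! i)"
| oracle_query: "computes p Oracle [x] (p x)"
| comp: "list_all2 (\<lambda>g y. computes p g xs y) gs ys \<Longrightarrow> computes p f ys z
    \<Longrightarrow> computes p (Comp f gs) xs z"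
| primrec_0: "computes p f xs y \<Longrightarrow> computes p (PrimRec f g) (0 # xs) y"
| primrec_Suc: "computes p (PrimRec f g) (n # xs) y \<Longrightarrow> computes p g (n # y # xs) z
    \<Longrightarrow> computes p (PrimRec f g) (Suc n # xs) z"
| mu: "computes p f (n # xs) 0 \<Longrightarrow> \<forall>m<n. \<exists>y. computes p f (m # xs) (Suc y)
    \<Longrightarrow> computes p (Mu f) xs n"

definition computable :: "(baire \<rightharpoonup> baire) \<Rightarrow> bool" where
  "computable F \<longleftrightarrow> (\<exists>c. \<forall>p r. F p = Some r \<longrightarrow> (\<forall>n. computes p c [n] (r n)))"

definition bpair :: "baire \<Rightarrow> baire \<Rightarrow> baire" where
  "bpair p q n = (if even n then p (n div 2) else q (n div 2))"

definition weihrauch_le :: "problem \<Rightarrow> problem \<Rightarrow> bool" where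
  "weihrauch_le f g \<longleftrightarrow> (\<exists>H K. computable H \<and> computable K \<and>
     (\<forall>G. realizer G g \<longrightarrow>
        realizer (\<lambda>p. Option.bind (K p) (\<lambda>k. Option.bind (G k) (\<lambda>q. H (bpair p q)))) f))"

definition weihrauch_equiv :: "problem \<Rightarrow> problem \<Rightarrow> bool" where
  "weihrauch_equiv f g \<longleftrightarrow> weihrauch_le f g \<and> weihrauch_le g f"

definition btuple :: "(nat \<Rightarrow> baire) \<Rightarrow> baire" where
  "btuple P n = (case prod_decode n of (i, j) \<Rightarrow> P i j)"

definition parallelization :: "problem \<Rightarrow> problem" where
  "parallelization f p = {btuple Q | Q. \<exists>P. p = btuple P \<and> (\<forall>i. Q i \<in> f (P i))}"

definition parallelizable :: "problem \<Rightarrow> bool" where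
  "parallelizable f \<longleftrightarrow> weihrauch_equiv f (parallelization f)"

end

theory Submission
  imports Defs
begin

text \<open>
  Let \<open>g p\<close> consist of all \<open>r\<close> other than \<open>d p\<close>, for a suitable partial function \<open>d\<close>, and let \<open>f\<close> be
  the parallelization of \<open>g\<close>; parallelizability is then automatic, since parallelization is
  idempotent. The function \<open>d\<close> comes from a transfinite recursion of length at most the continuum
  along the continuous functions \<open>F\<close>. At stage \<open>F\<close>, a fresh point \<open>p\<close> receives the value
  \<open>d p = F\<langle>p,p,\<dots>\<rangle>\<^sub>0\<close>, so that \<open>F\<close> does not realize \<open>f\<close>. Then \<open>y\<close> is chosen outside the values
  assigned so far, and the components of \<open>F(s\<^sub>y)\<close> on which \<open>d\<close> is not yet defined are kept out of its
  domain forever, where \<open>s\<^sub>y\<close> is a code of the constant function with value \<open>\<langle>y,y,\<dots>\<rangle>\<close>. Hence that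
  constant function solves \<open>f\<close> at \<open>F(s\<^sub>y)\<close>, and \<open>F\<close> does not witness effective discontinuity. Every
  stage uses only countably many points, so before stage \<open>F\<close> fewer than continuum many are used.
\<close>

section \<open>Computability of re-tupling\<close>

definition bproj :: "baire \<Rightarrow> nat \<Rightarrow> baire" where
  "bproj p i j = p (prod_encode (i, j))"

lemma bproj_btuple [simp]: "bproj (btuple P) = P"
  by (simp add: bproj_def btuple_def fun_eq_iff)

lemma btuple_bproj [simp]: "btuple (bproj p) = p"
proof
  fix n
  obtain i j where "prod_decode n = (i, j)" by (cases "prod_decode n")
  then show "btuple (bproj p) n = p n"
    by (metis bproj_def btuple_def case_prod_conv prod_decode_inverse)
qed

lemma mem_parallelization_iff:
  "r \<in> parallelization f p \<longleftrightarrow> (\<forall>i. bproj r i \<in> f (bproj p i))"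
proof
  assume "\<forall>i. bproj r i \<in> f (bproj p i)"
  then show "r \<in> parallelization f p"
    unfolding parallelization_def mem_Collect_eq
    by (intro exI[of _ "bproj r"] exI[of _ "bproj p"] conjI) simp_all
qed (auto simp: parallelization_def)

section \<open>Programs for arithmetic and for Cantor pairing and unpairing\<close>

lemma computes_Comp1:
  assumes "computes p g xs y" "computes p f [y] z"
  shows "computes p (Comp f [g]) xs z"
  using assms by (intro computes.comp[of p xs "[g]" "[y]"]) auto

lemma computes_Comp2:
  assumes "computes p g xs y" "computes p g' xs y'" "computes p f [y, y'] z"
  shows "computes p (Comp f [g, g']) xs z"
  using assms by (intro computes.comp[of p xs "[g, g']" "[y, y']"]) auto

lemma computes_Proj: "i < length xs \<Longrightarrow> y = xs ! i \<Longrightarrow> computes p (Proj i) xs y"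
  using computes.proj by simp

lemma computes_Succ: "computes p g xs y \<Longrightarrow> computes p (Comp Succ [g]) xs (Suc y)"
  by (rule computes_Comp1[OF _ computes.succ])

lemma computes_Oracle: "computes p g xs y \<Longrightarrow> computes p (Comp Oracle [g]) xs (p y)"
  by (rule computes_Comp1[OF _ computes.oracle_query])

definition rec_add :: recf where
  "rec_add = PrimRec (Proj 0) (Comp Succ [Proj 1])"

definition rec_dec :: recf where
  "rec_dec = PrimRec Zero (Proj 0)"

text \<open>Truncated subtraction with reversed arguments: \<open>PrimRec\<close> recurses on its
  first argument, here the number to be subtracted.\<close>

definition rec_rsub :: recf where
  "rec_rsub = PrimRec (Proj 0) (Comp rec_dec [Proj 1])"

definition rec_triangle :: recf where
  "rec_triangle = PrimRec Zero (Comp rec_add [Proj 1, Comp Succ [Proj 0]])"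

lemma computes_rec_add: "computes p rec_add [m, n] (m + n)"
  unfolding rec_add_def
proof (induction m)
  case 0
  show ?case by (rule computes.primrec_0, rule computes_Proj) auto
next
  case (Suc m)
  show ?case
    unfolding add_Suc
    by (rule computes.primrec_Suc[OF Suc], rule computes_Succ, rule computes_Proj) auto
qed

lemma computes_rec_dec: "computes p rec_dec [n] (n - 1)"
  unfolding rec_dec_def
proof (induction n)
  case 0
  show ?case using computes.primrec_0[OF computes.zero] by simp
next
  case (Suc n)
  show ?case by (rule computes.primrec_Suc[OF Suc], rule computes_Proj) auto
qed

lemma computes_rec_rsub: "computes p rec_rsub [m, n] (n - m)"
  unfolding rec_rsub_def
proof (induction m)
  case 0
  show ?case by (rule computes.primrec_0, rule computes_Proj) auto
next
  case (Suc m)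
  have "computes p (Comp rec_dec [Proj 1]) [m, n - m, n] (n - m - 1)"
    by (rule computes_Comp1[OF _ computes_rec_dec], rule computes_Proj) auto
  from computes.primrec_Suc[OF Suc this] show ?case by simp
qed

lemma computes_rec_triangle: "computes p rec_triangle [n] (triangle n)"
  unfolding rec_triangle_def
proof (induction n)
  case 0
  show ?case unfolding triangle_0 by (rule computes.primrec_0, rule computes.zero)
next
  case (Suc n)
  show ?case
    unfolding triangle_Suc
    by (rule computes.primrec_Suc[OF Suc], rule computes_Comp2[OF _ _ computes_rec_add],
        rule computes_Proj, simp, simp, rule computes_Succ, rule computes_Proj) auto
qed

text \<open>Raising the code \<open>n\<close> by one makes the truncated difference vanish exactly
  when \<open>triangle (Suc k) > n\<close>, not merely \<open>\<ge> n\<close>.\<close>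

definition rec_diagonal :: recf where
  "rec_diagonal =
     Mu (Comp rec_rsub [Comp rec_triangle [Comp Succ [Proj 0]], Comp Succ [Proj 1]])"

lemma triangle_mono: "m \<le> n \<Longrightarrow> triangle m \<le> triangle n"
  by (induction rule: dec_induct) auto

text \<open>
  The code of \<open>(a, b)\<close> is \<open>triangle (a + b) + a\<close>, so \<open>a + b\<close> is the least \<open>k\<close> such that
  \<open>triangle (Suc k)\<close> exceeds the code.
\<close>

lemma computes_rec_diagonal:
  assumes "prod_decode n = (a, b)"
  shows "computes p rec_diagonal [n] (a + b)"
proof -
  let ?f = "Comp rec_rsub [Comp rec_triangle [Comp Succ [Proj 0]], Comp Succ [Proj 1]]"
  have n: "n = triangle (a + b) + a"
    using prod_decode_inverse[of n] assms by (simp add: prod_encode_def)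
  have f: "computes p ?f [k, n] (Suc n - triangle (Suc k))" for k
    by (rule computes_Comp2[OF _ _ computes_rec_rsub],
        rule computes_Comp1[OF _ computes_rec_triangle], rule computes_Succ, rule computes_Proj,
        simp, simp, rule computes_Succ, rule computes_Proj) auto
  have "computes p ?f [a + b, n] 0"
    using f[of "a + b"] n by simp
  moreover have "\<exists>y. computes p ?f [m, n] (Suc y)" if "m < a + b" for m
  proof -
    have "triangle (Suc m) \<le> n"
      using triangle_mono[of "Suc m" "a + b"] that n by linarith
    then have "Suc n - triangle (Suc m) = Suc (n - triangle (Suc m))"
      by (rule Suc_diff_le)
    then show ?thesis using f[of m] by metis
  qed
  ultimately show ?thesis
    unfolding rec_diagonal_def by (intro computes.mu) auto
qed

definition rec_fst :: recf where
  "rec_fst = Comp rec_rsub [Comp rec_triangle [rec_diagonal], Proj 0]"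

definition rec_snd :: recf where
  "rec_snd = Comp rec_rsub [rec_fst, rec_diagonal]"

definition rec_pair :: recf where
  "rec_pair = Comp rec_add [Comp rec_triangle [rec_add], Proj 0]"

lemma computes_rec_fst:
  assumes "prod_decode n = (a, b)"
  shows "computes p rec_fst [n] a"
proof -
  have "n - triangle (a + b) = a"
    using prod_decode_inverse[of n] assms by (simp add: prod_encode_def)
  moreover have "computes p rec_fst [n] (n - triangle (a + b))"
    unfolding rec_fst_def
    by (rule computes_Comp2[OF _ _ computes_rec_rsub],
        rule computes_Comp1[OF computes_rec_diagonal[OF assms] computes_rec_triangle],
        rule computes_Proj) auto
  ultimately show ?thesis by simp
qed

lemma computes_rec_snd:
  assumes "prod_decode n = (a, b)"
  shows "computes p rec_snd [n] b"
  using computes_Comp2[OF computes_rec_fst[OF assms] computes_rec_diagonal[OF assms]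
      computes_rec_rsub]
  by (simp add: rec_snd_def)

lemma computes_rec_pair: "computes p rec_pair [a, b] (prod_encode (a, b))"
  unfolding rec_pair_def prod_encode_def prod.case
  by (intro computes_Comp2[OF _ _ computes_rec_add] computes_Comp1[OF computes_rec_add]
      computes_rec_triangle computes_Proj) auto

lemma computes_fst:
  "computes p c xs n \<Longrightarrow> computes p (Comp rec_fst [c]) xs (fst (prod_decode n))"
  by (rule computes_Comp1, assumption, rule computes_rec_fst) (rule surjective_pairing)

lemma computes_snd:
  "computes p c xs n \<Longrightarrow> computes p (Comp rec_snd [c]) xs (snd (prod_decode n))"
  by (rule computes_Comp1, assumption, rule computes_rec_snd) (rule surjective_pairing)

lemma computes_pair:
  "computes p c xs m \<Longrightarrow> computes p c' xs n \<Longrightarrow>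
   computes p (Comp rec_pair [c, c']) xs (prod_encode (m, n))"
  by (rule computes_Comp2, assumption, assumption, rule computes_rec_pair)

section \<open>Weihrauch reductions between a problem and its parallelizations\<close>

definition bsnd :: "baire \<Rightarrow> baire" where
  "bsnd p n = p (Suc (n + n))"

lemma bsnd_bpair [simp]: "bsnd (bpair p q) = q"
proof
  fix n
  have "Suc (n + n) div 2 = n" "odd (Suc (n + n))" by presburger+
  then show "bsnd (bpair p q) n = q n" by (simp only: bsnd_def bpair_def if_False)
qed

lemma computes_bsnd:
  "computes p c xs n \<Longrightarrow> computes p (Comp Oracle [Comp Succ [Comp rec_add [c, c]]]) xs (bsnd p n)"
  unfolding bsnd_def
  by (intro computes_Oracle computes_Succ computes_Comp2[OF _ _ computes_rec_add])

lemma computable_totalI: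
  assumes "\<And>p n. computes p c [n] (F p n)"
  shows "computable (\<lambda>p. Some (F p))"
  unfolding computable_def using assms by auto

lemma computes_Proj0: "computes p (Proj 0) [n] n"
  by (rule computes_Proj) auto

text \<open>The reductions below only re-index, so total \<open>H\<close> and \<open>K\<close>
  suffice, and realizers can be replaced by single solutions \<open>q\<close>.\<close>

lemma weihrauch_leI:
  assumes "computable (\<lambda>p. Some (H p))" "computable (\<lambda>p. Some (K p))"
    and dom: "\<And>p. p \<in> pdom f \<Longrightarrow> K p \<in> pdom g"
    and sol: "\<And>p q. p \<in> pdom f \<Longrightarrow> q \<in> g (K p) \<Longrightarrow> H (bpair p q) \<in> f p"
  shows "weihrauch_le f g"
  unfolding weihrauch_le_def
proof (intro exI conjI allI impI)
  fix G assume G: "realizer G g"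
  show "realizer (\<lambda>p. Option.bind (Some (K p))
     (\<lambda>k. Option.bind (G k) (\<lambda>q. Some (H (bpair p q))))) f"
    unfolding realizer_def
  proof
    fix p assume p: "p \<in> pdom f"
    then obtain q where "G (K p) = Some q" "q \<in> g (K p)"
      using G dom unfolding realizer_def by blast
    then show "\<exists>r. Option.bind (Some (K p))
       (\<lambda>k. Option.bind (G k) (\<lambda>q. Some (H (bpair p q)))) = Some r \<and> r \<in> f p"
      using sol[OF p] by simp
  qed
qed (use assms in auto)

text \<open>The instance is copied into every component, and component 0 of the answer is read
  off.\<close>

lemma weihrauch_le_parallelization: "weihrauch_le f (parallelization f)"
proof (rule weihrauch_leI)
  show "computable (\<lambda>p. Some (\<lambda>n. bsnd p (prod_encode (0, n))))"
    by (rule computable_totalI)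
      (rule computes_bsnd, rule computes_pair, rule computes.zero, rule computes_Proj0)
  show "computable (\<lambda>p. Some (\<lambda>n. p (snd (prod_decode n))))"
    by (rule computable_totalI) (rule computes_Oracle, rule computes_snd, rule computes_Proj0)
  fix p
  have K: "bproj (\<lambda>n. p (snd (prod_decode n))) i = p" for i
    by (simp add: bproj_def fun_eq_iff)
  assume p: "p \<in> pdom f"
  then obtain r where "r \<in> f p" by (auto simp: pdom_def)
  then have "btuple (\<lambda>_. r) \<in> parallelization f (\<lambda>n. p (snd (prod_decode n)))"
    by (simp add: mem_parallelization_iff K)
  then show "(\<lambda>n. p (snd (prod_decode n))) \<in> pdom (parallelization f)"
    by (auto simp: pdom_def)
  fix q assume "q \<in> parallelization f (\<lambda>n. p (snd (prod_decode n)))"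
  then have "bproj q 0 \<in> f p" by (simp add: mem_parallelization_iff K)
  then show "(\<lambda>n. bsnd (bpair p q) (prod_encode (0, n))) \<in> f p"
    by (simp add: bproj_def[abs_def])
qed

text \<open>A sequence of sequences is flattened along the Cantor pairing: \<open>K\<close> flattens
  the instance and \<open>H\<close> unflattens the answer.\<close>

lemma parallelization_idem_le:
  "weihrauch_le (parallelization (parallelization f)) (parallelization f)"
proof (rule weihrauch_leI)
  let ?D = prod_decode and ?E = prod_encode
  define K :: "baire \<Rightarrow> baire" where
    "K p n = p (?E (fst (?D (fst (?D n))), ?E (snd (?D (fst (?D n))), snd (?D n))))" for p n
  define H :: "baire \<Rightarrow> baire" where
    "H p n = bsnd p (?E (?E (fst (?D n), fst (?D (snd (?D n)))), snd (?D (snd (?D n)))))" for p n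
  show "computable (\<lambda>p. Some (H p))"
    by (rule computable_totalI, unfold H_def)
      (rule computes_bsnd computes_pair computes_fst computes_snd computes_Proj0)+
  show "computable (\<lambda>p. Some (K p))"
    by (rule computable_totalI, unfold K_def)
      (rule computes_Oracle computes_pair computes_fst computes_snd computes_Proj0)+
  have K: "bproj (K p) m = bproj (bproj p (fst (?D m))) (snd (?D m))" for p m
    by (simp add: K_def bproj_def fun_eq_iff)
  have H: "bproj (bproj (H (bpair p q)) i) k = bproj q (?E (i, k))" for p q i k
    by (simp add: H_def bproj_def fun_eq_iff)
  fix p
  assume "p \<in> pdom (parallelization (parallelization f))"
  then obtain r where "\<forall>i k. bproj (bproj r i) k \<in> f (bproj (bproj p i) k)"
    by (auto simp: pdom_def mem_parallelization_iff)
  \<comment> \<open>Flattening a solution \<open>r\<close> of \<open>p\<close> solves the flattened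
    instance, so \<open>K p\<close> lies in the domain.\<close>
  then have "K r \<in> parallelization f (K p)"
    by (simp add: mem_parallelization_iff K)
  then show "K p \<in> pdom (parallelization f)" by (auto simp: pdom_def)
  fix q assume "q \<in> parallelization f (K p)"
  then have q: "bproj q m \<in> f (bproj (bproj p (fst (?D m))) (snd (?D m)))" for m
    by (simp add: mem_parallelization_iff K)
  show "H (bpair p q) \<in> parallelization (parallelization f) p"
    using q[of "?E (i, k)" for i k] by (simp add: mem_parallelization_iff H)
qed

lemma parallelizable_parallelization: "parallelizable (parallelization f)"
  unfolding parallelizable_def weihrauch_equiv_def
  using weihrauch_le_parallelization parallelization_idem_le by blast

section \<open>Continuous functions on Baire space\<close>

text \<open>The index lists the monotone word function sending \<open>w\<close> to the prefix of
  \<open>r\<close> of the same length, so the output grows along every \<open>p\<close>.\<close>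

lemma Phi_constant: "\<exists>q. \<forall>p. Phi q p = Some r"
proof -
  define h :: "nat list \<Rightarrow> nat list" where "h w = initial r (length w)" for w
  define q where "q i = prod_encode (i, list_encode (h (list_decode i)))" for i
  have "prefix (h w) (h w')" if "prefix w w'" for w w'
  proof -
    have "[0..<length w'] = [0..<length w] @ [length w..<length w']"
      using prefix_length_le[OF that] upt_add_eq_append[of 0 "length w" "length w' - length w"]
      by simp
    then show ?thesis by (simp add: h_def initial_def)
  qed
  moreover have "entry q i = (list_decode i, h (list_decode i))" for i
    by (simp add: entry_def q_def)
  then have "range (entry q) = {(w, h w) | w. True}"
    by (force simp: image_iff intro: exI[of _ "list_encode w" for w])
  ultimately have w: "word_fun q = h" by (intro word_fun_eq)
  have len: "length (word_fun q (initial p m)) = m" for p m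
    by (simp add: w h_def initial_def)
  have "Phi q p = Some r" for p
  proof -
    have "\<forall>n. \<exists>m. n < length (word_fun q (initial p m))"
      unfolding len by blast
    then obtain s where s: "Phi q p = Some s" by (simp add: Phi_def)
    have "s n = r n" for n
    proof -
      obtain k where k: "initial r (Suc n) = initial s k"
        using Phi_eq_SomeD[OF s, of "Suc n"] by (auto simp: w h_def initial_def)
      from arg_cong[OF k, of length] have "k = Suc n" by (simp add: initial_def)
      with k show ?thesis by (simp add: initial_def)
    qed
    with s show ?thesis by auto
  qed
  then show ?thesis by blast
qed

section \<open>A countable dense set and the number of continuous functions\<close>

definition pad :: "nat list \<Rightarrow> baire" where
  "pad w n = (if n < length w then w ! n else 0)"

lemma pad_initial_tendsto: "(\<lambda>m. pad (initial p m)) \<longlonglongrightarrow> p"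
proof -
  have "(\<lambda>m. pad (initial p m) i) \<longlonglongrightarrow> p i" for i
  proof (rule tendsto_eventually)
    show "\<forall>\<^sub>F m in sequentially. pad (initial p m) i = p i"
      using eventually_gt_at_top[of i] by eventually_elim (simp add: pad_def initial_def)
  qed
  then have "limitin (product_topology (\<lambda>_. euclidean) UNIV) (\<lambda>m. pad (initial p m)) p sequentially"
    by (simp add: limitin_componentwise)
  then show ?thesis by (simp add: euclidean_product_topology)
qed

lemma continuous_eq_if_eq_on_pad:
  fixes F G :: "baire \<Rightarrow> baire"
  assumes "continuous_on UNIV F" "continuous_on UNIV G" "\<And>w. F (pad w) = G (pad w)"
  shows "F = G"
proof (intro ext)
  fix p n
  have lim: "(\<lambda>m. H (pad (initial p m)) n) \<longlonglongrightarrow> H p n"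
    if "continuous_on UNIV H" for H :: "baire \<Rightarrow> baire"
    by (rule continuous_on_tendsto_compose[OF
          continuous_on_product_then_coordinatewise[OF that] pad_initial_tendsto]) auto
  show "F p n = G p n"
    using lim[OF assms(1)] lim[OF assms(2)] unfolding assms(3) by (rule LIMSEQ_unique)
qed

text \<open>A continuous function is determined by its values on the countably many points
  \<open>pad w\<close>, and these values fit into one point of Baire space.\<close>

lemma card_continuous_le:
  includes cardinal_syntax
  shows "|{F :: baire \<Rightarrow> baire. continuous_on UNIV F}| \<le>o |UNIV :: baire set|"
proof (rule card_of_ordLeqI)
  let ?code = "\<lambda>F :: baire \<Rightarrow> baire. btuple (\<lambda>i. F (pad (list_decode i)))"
  show "inj_on ?code {F. continuous_on UNIV F}"
  proof (rule inj_onI)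
    fix F G
    assume FG: "F \<in> {F. continuous_on UNIV F}" "G \<in> {F. continuous_on UNIV F}"
      and code: "?code F = ?code G"
    have "F (pad (list_decode i)) = G (pad (list_decode i))" for i
      using fun_cong[OF arg_cong[OF code, of bproj], of i] unfolding bproj_btuple .
    then have "F (pad w) = G (pad w)" for w by (metis list_encode_inverse)
    then show "F = G" using FG by (intro continuous_eq_if_eq_on_pad) simp_all
  qed
qed simp

lemma uncountable_baire: "uncountable (UNIV :: baire set)"
proof
  assume "countable (UNIV :: baire set)"
  then obtain e :: "nat \<Rightarrow> baire" where e: "surj e"
    using uncountable_def by blast
  obtain n where "e n = (\<lambda>k. Suc (e k k))" using e by (metis surjD)
  from fun_cong[OF this, of n] show False by simp
qed

section \<open>The diagonal construction\<close>

text \<open>For finite \<open>U\<close> the forbidden set is countable; for infinite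
  \<open>U\<close> it has at most the size of \<open>U\<close>, as a factor \<open>nat\<close> does
  not enlarge an infinite set.\<close>

lemma exists_not_in_small_image:
  includes cardinal_syntax
  fixes f :: "'b \<times> nat \<Rightarrow> 'a"
  assumes unc: "uncountable (UNIV :: 'a set)" and U: "|U| <o |UNIV :: 'a set|"
  shows "\<exists>x. x \<noteq> z \<and> x \<notin> f ` (U \<times> UNIV)"
proof (cases "finite U")
  case True
  then have "countable (insert z (f ` (U \<times> UNIV)))"
    by (simp add: countable_finite)
  then have "insert z (f ` (U \<times> UNIV)) \<noteq> UNIV" using unc by metis
  then show ?thesis by blast
next
  case False
  have inf: "infinite (UNIV :: 'a set)" using unc by (rule uncountable_infinite)
  have "|U \<times> (UNIV :: nat set)| =o |U|"
    using False infinite_iff_card_of_nat by (intro card_of_Times_infinite_simps(1)) auto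
  then have "|f ` (U \<times> UNIV)| \<le>o |U|"
    using card_of_image ordLeq_ordIso_trans by blast
  then have *: "|f ` (U \<times> UNIV)| <o |UNIV :: 'a set|"
    using U ordLeq_ordLess_trans by blast
  have "|{z}| \<le>o |U|" using False by (intro card_of_singl_ordLeq) auto
  then have "|{z}| <o |UNIV :: 'a set|" using U ordLeq_ordLess_trans by blast
  then have "|{z} \<union> f ` (U \<times> UNIV)| <o |UNIV :: 'a set|"
    using * inf by (intro card_of_Un_ordLess_infinite)
  then have "{z} \<union> f ` (U \<times> UNIV) \<noteq> UNIV" using ordLess_irreflexive by metis
  then show ?thesis by blast
qed

text \<open>Both requirements on \<open>d\<close> are met in one recursion over \<open>C\<close>:
  \<open>\<phi> a p\<close> is the value to be hit at stage \<open>a\<close>, and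
  \<open>E a y\<close> lists the points where \<open>y\<close> must be missed.\<close>

lemma diagonal_partial_function:
  includes cardinal_syntax
  fixes \<phi> :: "'i \<Rightarrow> 'a \<Rightarrow> 'a" and E :: "'i \<Rightarrow> 'a \<Rightarrow> nat \<Rightarrow> 'a"
  assumes unc: "uncountable (UNIV :: 'a set)" and C: "|C| \<le>o |UNIV :: 'a set|"
  shows "\<exists>d :: 'a \<rightharpoonup> 'a. (\<forall>a\<in>C. \<exists>p. d p = Some (\<phi> a p)) \<and>
    (\<forall>a\<in>C. \<exists>y. \<forall>i. d (E a y i) \<noteq> Some y)"
proof -
  \<comment> \<open>The cardinal \<open>|C|\<close> is a well-order of \<open>C\<close> of least
    length, so its proper initial segments are smaller than \<open>C\<close>.\<close>
  define R where "R = |C| - Id"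
  have wo: "well_order_on C |C|" by (rule card_of_well_order_on)
  then have "wf R" unfolding R_def well_order_on_def by blast
  have total: "(a, b) \<in> R \<or> (b, a) \<in> R" if "a \<in> C" "b \<in> C" "a \<noteq> b" for a b
    using wo that
    unfolding R_def well_order_on_def linear_order_on_def total_on_def by auto
  have small: "|{b. (b, a) \<in> R}| <o |UNIV :: 'a set|" if "a \<in> C" for a
  proof -
    have "{b. (b, a) \<in> R} = underS |C| a" by (auto simp: R_def underS_def)
    moreover have "|underS |C| a| <o |C|"
      using that by (intro card_of_underS card_of_Card_order) (simp add: Field_card_of)
    ultimately show ?thesis using ordLess_ordLeq_trans[OF _ C] by simp
  qed
  \<comment> \<open>Stage \<open>a\<close> picks a pair \<open>r\<close> of a new point for the
    domain of \<open>d\<close> and a value to be missed. The last clause separates that value from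
    the one assigned at the same stage.\<close>
  define P where "P g a r \<longleftrightarrow> (a \<in> C \<longrightarrow>
      (\<forall>b. (b, a) \<in> R \<longrightarrow> fst r \<noteq> fst (g b) \<and> (\<forall>i. fst r \<noteq> E b (snd (g b)) i) \<and>
         snd r \<noteq> \<phi> b (fst (g b))) \<and>
      snd r \<noteq> \<phi> a (fst r))" for g :: "'i \<Rightarrow> 'a \<times> 'a" and a r
  have "\<exists>g. \<forall>a. P g a (g a)"
  proof (rule dependent_wf_choice[OF \<open>wf R\<close>])
    show "P f a r = P g a r" if "\<And>b. (b, a) \<in> R \<Longrightarrow> f b = g b" for f g a r
      unfolding P_def using that by auto
    fix a and g :: "'i \<Rightarrow> 'a \<times> 'a"
    show "\<exists>r. P g a r"
    proof (cases "a \<in> C")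
      case True
      let ?U = "{b. (b, a) \<in> R}"
      \<comment> \<open>Each earlier stage forbids its own point (\<open>n = 0\<close>) and the
        countably many points reserved by it.\<close>
      define used where "used = (\<lambda>(b, n). case n of 0 \<Rightarrow> fst (g b) | Suc i \<Rightarrow> E b (snd (g b)) i)"
      obtain p where p: "p \<notin> used ` (?U \<times> UNIV)"
        using exists_not_in_small_image[OF unc small[OF True], of _ used] by blast
      obtain y where y: "y \<noteq> \<phi> a p" "y \<notin> (\<lambda>(b, _ :: nat). \<phi> b (fst (g b))) ` (?U \<times> UNIV)"
        using exists_not_in_small_image[OF unc small[OF True], of "\<phi> a p"
            "\<lambda>(b, _). \<phi> b (fst (g b))"] by blast
      have "p \<noteq> fst (g b)" "p \<noteq> E b (snd (g b)) i" if "(b, a) \<in> R" for b i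
      proof -
        have "p \<noteq> used (b, n)" for n using p that by blast
        from this[of 0] this[of "Suc i"]
        show "p \<noteq> fst (g b)" "p \<noteq> E b (snd (g b)) i" by (simp_all add: used_def)
      qed
      moreover have "y \<noteq> \<phi> b (fst (g b))" if "(b, a) \<in> R" for b
        using y(2) that by force
      ultimately have "P g a (p, y)" using y(1) by (simp add: P_def)
      then show ?thesis ..
    qed (simp add: P_def)
  qed
  then obtain g where g: "\<And>a. P g a (g a)" by blast
  define pt where "pt a = fst (g a)" for a
  define val where "val a = snd (g a)" for a
  have fresh: "pt a \<noteq> pt b" "pt a \<noteq> E b (val b) i" "val a \<noteq> \<phi> b (pt b)"
    if "(b, a) \<in> R" "a \<in> C" for a b i
    using g[of a] that unfolding P_def pt_def val_def by blast+
  have fresh_self: "val a \<noteq> \<phi> a (pt a)" if "a \<in> C" for a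
    using g[of a] that unfolding P_def pt_def val_def by blast
  define d where "d p = (if p \<in> pt ` C then Some (\<phi> (inv_into C pt p) p) else None)" for p
  have "inj_on pt C"
  proof (rule inj_onI, rule ccontr)
    fix a b assume "a \<in> C" "b \<in> C" "pt a = pt b" "a \<noteq> b"
    then show False using total[of a b] fresh(1)[of a b] fresh(1)[of b a] by auto
  qed
  then have d: "d (pt a) = Some (\<phi> a (pt a))" if "a \<in> C" for a
    using that by (simp add: d_def)
  \<comment> \<open>A violation would come from some stage \<open>c\<close>. If \<open>c\<close> is
    later than \<open>a\<close>, its point avoids the reserved ones; otherwise \<open>val a\<close>
    was chosen different from the value assigned at \<open>c\<close>.\<close>
  have miss: "d (E a (val a) i) \<noteq> Some (val a)" if a: "a \<in> C" for a i
  proof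
    assume eq: "d (E a (val a) i) = Some (val a)"
    then have "E a (val a) i \<in> pt ` C"
      unfolding d_def by (meson option.distinct(1))
    then obtain c where c: "c \<in> C" "pt c = E a (val a) i" by auto
    then have v: "val a = \<phi> c (pt c)" using eq d[of c] by simp
    have "(a, c) \<notin> R" using fresh(2)[of a c i] c by blast
    moreover have "(c, a) \<notin> R" using fresh(3)[of c a] a v by blast
    moreover have "c \<noteq> a" using fresh_self[OF a] v by blast
    ultimately show False using total[OF a c(1)] by blast
  qed
  show ?thesis
  proof (intro exI[of _ d] conjI ballI)
    show "\<exists>p. d p = Some (\<phi> a p)" if "a \<in> C" for a using d[OF that] ..
    show "\<exists>y. \<forall>i. d (E a y i) \<noteq> Some y" if "a \<in> C" for a using miss[OF that] by blast
  qed
qed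

theorem theorem23:
  "\<exists>f :: problem. total_problem f \<and> parallelizable f \<and> discontinuous f \<and>
     \<not> effectively_discontinuous f"
proof -
  define const where "const y = btuple (\<lambda>_. y)" for y
  obtain s where s: "\<And>y p. Phi (s y) p = Some (const y)"
    using Phi_constant[of "const y" for y] by metis
  let ?C = "{F :: baire \<Rightarrow> baire. continuous_on UNIV F}"
  obtain d :: "baire \<rightharpoonup> baire"
    where hit: "\<forall>F\<in>?C. \<exists>p. d p = Some (bproj (F (const p)) 0)"
      and miss: "\<forall>D\<in>?C. \<exists>y. \<forall>i. d (bproj (D (s y)) i) \<noteq> Some y"
    using diagonal_partial_function[OF uncountable_baire card_continuous_le,
        of "\<lambda>F p. bproj (F (const p)) 0" "\<lambda>D y. bproj (D (s y))"] by blast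
  define f where "f = parallelization (\<lambda>p. {r. d p \<noteq> Some r})"
  have f: "r \<in> f p \<longleftrightarrow> (\<forall>i. d (bproj p i) \<noteq> Some (bproj r i))" for r p
    by (simp add: f_def mem_parallelization_iff)
  have dom: "pdom f = UNIV"
  proof -
    \<comment> \<open>With two distinct points available, one of them always differs from
      \<open>d p\<close>.\<close>
    have "(\<lambda>_. 0 :: nat) \<noteq> (\<lambda>_ :: nat. 1)" by (simp add: fun_eq_iff)
    then have "\<exists>r. d p \<noteq> Some r" for p by (metis option.inject)
    then obtain R where "\<And>p. d p \<noteq> Some (R p)" by metis
    then have "btuple (\<lambda>i. R (bproj p i)) \<in> f p" for p by (simp add: f)
    then show ?thesis by (auto simp: pdom_def)
  qed
  have "discontinuous f"
    unfolding discontinuous_def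
  proof clarify
    fix F assume F: "realizer F f" "continuous_partial F"
    then have some: "\<exists>r. F p = Some r \<and> r \<in> f p" for p
      by (simp add: realizer_def dom)
    then have "dom F = UNIV" by (auto simp: dom_def)
    have sol: "the (F p) \<in> f p" for p using some[of p] by auto
    from \<open>dom F = UNIV\<close> have "(\<lambda>p. the (F p)) \<in> ?C" using F(2) by (simp add: continuous_partial_def)
    \<comment> \<open>Component 0 of the instance \<open>const p\<close> is \<open>p\<close>, so the
      realizer returns there exactly the forbidden value.\<close>
    then obtain p where "d p = Some (bproj (the (F (const p))) 0)" using hit by auto
    then show False using sol[of "const p"] by (auto simp: f const_def)
  qed
  moreover have "\<not> effectively_discontinuous f"
    unfolding effectively_discontinuous_def
  proof clarify
    fix D :: "baire \<Rightarrow> baire"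
    assume "continuous_on UNIV D"
      and D: "\<forall>q. D q \<in> pdom f \<and> (\<forall>r. Phi q (D q) = Some r \<longrightarrow> r \<notin> f (D q))"
    then obtain y where "\<forall>i. d (bproj (D (s y)) i) \<noteq> Some y" using miss by auto
    then have "const y \<in> f (D (s y))" by (simp add: f const_def)
    \<comment> \<open>The index \<open>s y\<close> defeats \<open>D\<close>: its function is
      constantly \<open>const y\<close>, a solution at \<open>D (s y)\<close>.\<close>
    then show False using D s by blast
  qed
  moreover have "parallelizable f"
    unfolding f_def by (rule parallelizable_parallelization)
  ultimately show ?thesis using dom unfolding total_problem_def by blast
qed

end
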